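(* Let $G$ be a connected bipartite graph with bipartition $(X,Y)$, and let $n\geq 3$ be an odd integer. If $|X|\geq\delta(G)+1$, $|Y|\geq\delta(G)+1$ and $\kappa(G)>\frac{2}{n}\delta(G)$, then $G\times C_{n}$ is super-$\kappa$.
   Context: All graphs are simple. $C_n$ is the cycle on $n$ vertices. The direct product $G\times H$ has vertex set $V(G)\times V(H)$, with $(u_1,v_1)(u_2,v_2)$ an edge iff $u_1u_2\in E(G)$ and $v_1v_2\in E(H)$. $\delta(G)$ is the minimum degree. For a non-complete graph $G$, the connectivity $\kappa(G)$ is the minimum size of a vertex set $S$ such that $G-S$ is disconnected; for a complete graph $\kappa(G)=|V(G)|-1$. A graph is super connected (super-$\kappa$) if every minimum vertex cut is the neighborhood of some vertex of minimum degree. *)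

theory Defs
  imports "Graph_Theory.Graph_Theory"
begin

text \<open>
  A finite simple graph is a \<^locale>\<open>pair_graph\<close>: an undirected edge is represented by
  its two opposite arcs, so \<^const>\<open>out_degree\<close> is the degree.
\<close>

definition bipartition :: "'a pair_pre_digraph \<Rightarrow> 'a set \<Rightarrow> 'a set \<Rightarrow> bool" where
  "bipartition G X Y \<longleftrightarrow>
     pverts G = X \<union> Y \<and> X \<inter> Y = {} \<and> parcs G \<subseteq> X \<times> Y \<union> Y \<times> X"

definition cycle_graph :: "nat \<Rightarrow> nat pair_pre_digraph" where
  "cycle_graph n =
     \<lparr> pverts = {..<n},
       parcs = {(i, j). i < n \<and> j < n \<and> (j = (i + 1) mod n \<or> i = (j + 1) mod n)} \<rparr>"

definition direct_product ::
    "'a pair_pre_digraph \<Rightarrow> 'b pair_pre_digraph \<Rightarrow> ('a \<times> 'b) pair_pre_digraph" where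
  "direct_product G H =
     \<lparr> pverts = pverts G \<times> pverts H,
       parcs = {((u1, v1), (u2, v2)) | u1 v1 u2 v2.
                  (u1, u2) \<in> parcs G \<and> (v1, v2) \<in> parcs H} \<rparr>"

definition neighborhood :: "'a pair_pre_digraph \<Rightarrow> 'a \<Rightarrow> 'a set" where
  "neighborhood G v = {u. (v, u) \<in> parcs G}"

definition min_degree :: "'a pair_pre_digraph \<Rightarrow> nat" where
  "min_degree G = Min (out_degree (with_proj G) ` pverts G)"

text \<open>
  The inclusion is strict because \<^const>\<open>Digraph_Component.connected\<close> is false for
  the null graph, which does not count as disconnected here.
\<close>

definition vertex_cut :: "'a pair_pre_digraph \<Rightarrow> 'a set \<Rightarrow> bool" where
  "vertex_cut G S \<longleftrightarrow>
     S \<subset> pverts G \<and> \<not> Digraph_Component.connected (with_proj G \<restriction> (pverts G - S))"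

definition connectivity :: "'a pair_pre_digraph \<Rightarrow> nat" where
  "connectivity G =
     (if complete_digraph (card (pverts G)) (with_proj G) then card (pverts G) - 1
      else (LEAST k. \<exists>S. vertex_cut G S \<and> card S = k))"

definition minimum_vertex_cut :: "'a pair_pre_digraph \<Rightarrow> 'a set \<Rightarrow> bool" where
  "minimum_vertex_cut G S \<longleftrightarrow> vertex_cut G S \<and> card S = connectivity G"

definition super_connected :: "'a pair_pre_digraph \<Rightarrow> bool" where
  "super_connected G \<longleftrightarrow>
     (\<forall>S. minimum_vertex_cut G S \<longrightarrow>
       (\<exists>v \<in> pverts G. out_degree (with_proj G) v = min_degree G \<and> S = neighborhood G v))"

lemma pair_graph_cycle_graph:
  assumes "n \<ge> 3"
  shows "pair_graph (cycle_graph n)"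
proof -
  have "finite (parcs (cycle_graph n))"
    by (rule finite_subset[of _ "{..<n} \<times> {..<n}"]) (auto simp: cycle_graph_def)
  moreover have "i \<noteq> Suc i mod n \<and> Suc i mod n \<noteq> i" if "i < n" for i
    using that assms by (cases "Suc i = n") auto
  ultimately show ?thesis
    by unfold_locales (auto simp: cycle_graph_def symmetric_def sym_def)
qed

lemma pair_graph_direct_product:
  assumes "pair_graph G" "pair_graph H"
  shows "pair_graph (direct_product G H)"
proof -
  interpret G: pair_graph G by fact
  interpret H: pair_graph H by fact
  let ?P = "direct_product G H"
  have wf: "parcs ?P \<subseteq> pverts ?P \<times> pverts ?P"
    by (auto simp: direct_product_def dest: G.in_arcsD1 G.in_arcsD2 H.in_arcsD1 H.in_arcsD2)
  have fin: "finite (pverts ?P)"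
    by (simp add: direct_product_def)
  have "finite (parcs ?P)"
    using wf fin by (meson finite_SigmaI finite_subset)
  moreover have "fst e \<noteq> snd e" if "e \<in> parcs ?P" for e
    using that G.pair_no_loops by (auto simp: direct_product_def)
  moreover have "sym (parcs ?P)"
    using G.pair_sym_arcs H.pair_sym_arcs
    by (auto simp: direct_product_def symmetric_def sym_def)
  ultimately show ?thesis
    using wf fin by unfold_locales (auto simp: symmetric_def)
qed

end

theory Submission
  imports Defs
begin

text \<open>
  For odd \<open>n\<close> and bipartite \<open>G\<close> the product unrolls into a cyclic sequence of \<open>2n\<close> layers
  \<open>X, Y, X, Y, \<dots>\<close>, where layer \<open>t\<close> lies over the vertex \<open>t mod n\<close> of the cycle and any two
  consecutive layers induce a copy of \<open>G\<close>. Let \<open>S\<close> be a minimum cut, so \<open>card S \<le> 2\<delta>\<close>. Each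
  vertex of \<open>S\<close> lies in two of the \<open>2n\<close> copies, hence on average a copy loses at most
  \<open>2\<delta>/n < \<kappa>(G)\<close> vertices, and some copy stays connected. Some union \<open>F\<close> of components of the rest
  avoids that copy. If \<open>a\<close> and \<open>b\<close> are the first and the last layer met by \<open>F\<close>, then \<open>S\<close> contains
  the neighbours of \<open>F\<close> in the layers \<open>a - 1\<close> and \<open>b + 1\<close>, at least \<open>\<delta>\<close> of them in each, and
  nothing else. If \<open>a = b\<close>, then \<open>S\<close> is a neighbourhood. If \<open>a < b\<close>, then connectedness of \<open>G\<close>
  forces \<open>F\<close> to contain the whole layer \<open>a\<close>, so \<open>S\<close> contains the whole layer \<open>a - 1\<close>, which has
  more than \<open>\<delta>\<close> vertices.
\<close>

section \<open>Connectedness and closed vertex sets\<close>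

text \<open>In a \<open>pair_graph\<close> these are exactly the unions of components of the
  subgraph induced on \<open>W\<close>.\<close>

definition edge_closed :: "'a pair_pre_digraph \<Rightarrow> 'a set \<Rightarrow> 'a set \<Rightarrow> bool" where
  "edge_closed G W C \<longleftrightarrow> C \<subseteq> W \<and> (\<forall>u\<in>C. \<forall>v\<in>W. (u, v) \<in> parcs G \<longrightarrow> v \<in> C)"

lemma edge_closedD:
  assumes "edge_closed G W C" "u \<in> C" "(u, v) \<in> parcs G" "v \<in> W"
  shows "v \<in> C"
  using assms by (auto simp: edge_closed_def)

lemma (in pair_graph) arc_sym: "(u, v) \<in> parcs G \<Longrightarrow> (v, u) \<in> parcs G"
  using pair_sym_arcs by (auto simp: symmetric_def sym_def)

lemma (in pair_graph) no_loop: "(u, u) \<notin> parcs G"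
  using pair_no_loops[of "(u, u)"] by auto

lemma (in pair_graph) edge_closed_compl:
  assumes "edge_closed G W C" shows "edge_closed G W (W - C)"
  using assms arc_sym by (auto simp: edge_closed_def)

text \<open>A closed set absorbs whatever is reachable from it, and the set reachable from one
  vertex is closed. Later arguments therefore need no walks.\<close>

lemma (in pair_graph) connected_induce_iff:
  assumes "W \<subseteq> pverts G"
  shows "Digraph_Component.connected (with_proj G \<restriction> W) \<longleftrightarrow>
    W \<noteq> {} \<and> (\<forall>C. edge_closed G W C \<and> C \<noteq> {} \<longrightarrow> C = W)"
proof -
  define R where "R = {(u, v). (u, v) \<in> parcs G \<and> u \<in> W \<and> v \<in> W}"
  have R: "parcs (mk_symmetric (with_proj G \<restriction> W)) = R"
    by (auto simp: parcs_mk_symmetric R_def induce_subgraph_def intro: arc_sym)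
  have conn: "Digraph_Component.connected (with_proj G \<restriction> W) \<longleftrightarrow>
      W \<noteq> {} \<and> (\<forall>u\<in>W. \<forall>v\<in>W. (u, v) \<in> rtrancl_on W R)"
    by (simp add: connected_def strongly_connected_def reachable_def R)
  have "C = W" if *: "\<forall>u\<in>W. \<forall>v\<in>W. (u, v) \<in> rtrancl_on W R"
    and C: "edge_closed G W C" "C \<noteq> {}" for C
  proof -
    obtain u where u: "u \<in> C" using C by auto
    have "v \<in> C" if "v \<in> W" for v
    proof -
      have "(u, v) \<in> rtrancl_on W R" using * u that C by (auto simp: edge_closed_def)
      then show ?thesis
      proof (induct rule: rtrancl_on_induct)
        case (step y z)
        then show ?case using edge_closedD[OF C(1)] by (auto simp: R_def)
      qed (use u in simp)
    qed
    then show ?thesis using C by (auto simp: edge_closed_def)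
  qed
  moreover have "(u, v) \<in> rtrancl_on W R"
    if *: "\<forall>C. edge_closed G W C \<and> C \<noteq> {} \<longrightarrow> C = W" and u: "u \<in> W" and v: "v \<in> W" for u v
  proof -
    let ?C = "{w. (u, w) \<in> rtrancl_on W R}"
    have "edge_closed G W ?C"
      by (auto simp: edge_closed_def R_def
          dest: in_rtrancl_on_in_F intro: rtrancl_on_into_rtrancl_on)
    moreover have "u \<in> ?C" using u by auto
    ultimately have "?C = W" using * by blast
    then show ?thesis using v by auto
  qed
  ultimately show ?thesis unfolding conn by blast
qed

lemma (in pair_graph) connected_iff:
  "Digraph_Component.connected (with_proj G) \<longleftrightarrow>
    pverts G \<noteq> {} \<and> (\<forall>C. edge_closed G (pverts G) C \<and> C \<noteq> {} \<longrightarrow> C = pverts G)"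
proof -
  have "with_proj G \<restriction> pverts G = with_proj G"
    by (auto simp: induce_subgraph_def with_proj_def dest: in_arcsD1 in_arcsD2)
  then show ?thesis using connected_induce_iff[of "pverts G"] by simp
qed

section \<open>Degrees and connectivity\<close>

lemma out_degree_eq_card_neighborhood:
  "out_degree (with_proj G) v = card (neighborhood G v)"
proof -
  have "out_arcs (with_proj G) v = Pair v ` neighborhood G v"
    by (auto simp: neighborhood_def out_arcs_def)
  then show ?thesis by (simp add: out_degree_def card_image inj_on_def)
qed

lemma (in pair_graph) neighborhood_subset: "neighborhood G v \<subseteq> pverts G"
  by (auto simp: neighborhood_def dest: in_arcsD2)

lemma (in pair_graph) min_degree_le:
  "v \<in> pverts G \<Longrightarrow> min_degree G \<le> card (neighborhood G v)"
  using pair_finite_verts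
  by (auto simp: min_degree_def out_degree_eq_card_neighborhood)

lemma (in pair_graph) min_degree_attained:
  assumes "pverts G \<noteq> {}"
  obtains v where "v \<in> pverts G" "card (neighborhood G v) = min_degree G"
proof -
  have "min_degree G \<in> out_degree (with_proj G) ` pverts G"
    unfolding min_degree_def using assms pair_finite_verts by (intro Min_in) auto
  then show ?thesis using that by (auto simp: out_degree_eq_card_neighborhood)
qed

text \<open>The nonadjacent pair rules out the complete-graph case of
  \<open>connectivity\<close>.\<close>

lemma connectivity_le_card_cut:
  assumes "vertex_cut G S" "u \<in> pverts G" "v \<in> pverts G" "u \<noteq> v" "(u, v) \<notin> parcs G"
  shows "connectivity G \<le> card S"
proof -
  have "\<not> complete_digraph (card (pverts G)) (with_proj G)"
    using assms by (auto simp: complete_digraph_pair_def)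
  then show ?thesis
    using assms(1) by (auto simp: connectivity_def intro: Least_le)
qed

lemma (in pair_graph) connectivity_le_card_neighborhood:
  assumes "v \<in> pverts G" "w \<in> pverts G" "v \<noteq> w" "(v, w) \<notin> parcs G"
  shows "connectivity G \<le> card (neighborhood G v)"
proof (rule connectivity_le_card_cut[OF _ assms])
  let ?W = "pverts G - neighborhood G v"
  have vw: "v \<in> ?W" "w \<in> ?W"
    using assms no_loop by (auto simp: neighborhood_def)
  \<comment> \<open>Deleting its neighbours isolates \<open>v\<close>, while \<open>w\<close>
    survives.\<close>
  then have "edge_closed G ?W {v}"
    by (auto simp: edge_closed_def neighborhood_def)
  then have "\<not> Digraph_Component.connected (with_proj G \<restriction> ?W)"
    using vw assms(3) connected_induce_iff[OF Diff_subset] by (metis insert_not_empty singletonD)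
  then show "vertex_cut G (neighborhood G v)"
    using neighborhood_subset[of v] vw unfolding vertex_cut_def by blast
qed

lemma (in pair_graph) connectivity_le_card:
  "connectivity G \<le> card (pverts G)"
proof (cases "complete_digraph (card (pverts G)) (with_proj G)")
  case True
  then show ?thesis by (simp add: connectivity_def)
next
  case False
  then have "parcs G \<noteq> {(v, w). (v, w) \<in> pverts G \<times> pverts G \<and> v \<noteq> w}"
    using pair_finite_verts by (simp add: complete_digraph_pair_def)
  moreover have "parcs G \<subseteq> {(v, w). (v, w) \<in> pverts G \<times> pverts G \<and> v \<noteq> w}"
    using no_loop by (auto dest: in_arcsD1 in_arcsD2)
  ultimately obtain v w where "v \<in> pverts G" "w \<in> pverts G" "v \<noteq> w" "(v, w) \<notin> parcs G"
    by blast
  then have "connectivity G \<le> card (neighborhood G v)"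
    by (rule connectivity_le_card_neighborhood)
  also have "\<dots> \<le> card (pverts G)"
    using neighborhood_subset pair_finite_verts by (rule card_mono[rotated])
  finally show ?thesis .
qed

lemma (in pair_graph) connected_after_small_removal:
  assumes "T \<subseteq> pverts G" "card T < connectivity G"
  shows "Digraph_Component.connected (with_proj G \<restriction> (pverts G - T))"
proof -
  \<comment> \<open>A vertex must remain: \<open>vertex_cut\<close> is about proper subsets, and the
    null graph is not connected.\<close>
  have T: "T \<noteq> pverts G" using assms(2) connectivity_le_card by auto
  show ?thesis
  proof (cases "complete_digraph (card (pverts G)) (with_proj G)")
    case True
    then have arcs: "(u, v) \<in> parcs G" if "u \<in> pverts G" "v \<in> pverts G" "u \<noteq> v" for u v
      using that by (simp add: complete_digraph_pair_def)
    have "C = pverts G - T" if "edge_closed G (pverts G - T) C" "C \<noteq> {}" for C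
      using that arcs unfolding edge_closed_def by blast
    then show ?thesis using T assms(1) connected_induce_iff[OF Diff_subset] by blast
  next
    case False
    then have "\<not> (\<exists>S. vertex_cut G S \<and> card S = card T)"
      using assms(2) not_less_Least[of "card T" "\<lambda>k. \<exists>S. vertex_cut G S \<and> card S = k"]
      by (simp add: connectivity_def)
    then show ?thesis using T assms(1) by (auto simp: vertex_cut_def)
  qed
qed

section \<open>The layers of the product with an odd cycle\<close>

locale bipartite_times_odd_cycle = pair_graph G
  for G :: "'a pair_pre_digraph" and X Y :: "'a set" and n :: nat +
  assumes bip: "bipartition G X Y" and n_ge: "n \<ge> 3" and n_odd: "odd n"
begin

abbreviation H :: "('a \<times> nat) pair_pre_digraph" where
  "H \<equiv> direct_product G (cycle_graph n)"

definition side :: "nat \<Rightarrow> 'a set" where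
  "side t = (if even t then X else Y)"

text \<open>The trace on a layer is kept as a subset of \<open>pverts G\<close>, so that two
  consecutive layers can be compared with sets in \<open>G\<close>. The index runs over all
  naturals, with period \<open>2 * n\<close>.\<close>

definition layer :: "('a \<times> nat) set \<Rightarrow> nat \<Rightarrow> 'a set" where
  "layer S t = {u \<in> side t. (u, t mod n) \<in> S}"

sublocale H: pair_graph H
  using pair_graph_direct_product[OF _ pair_graph_cycle_graph[OF n_ge]] pair_graph_axioms by blast

lemma pverts_H: "pverts H = pverts G \<times> {..<n}"
  by (simp add: direct_product_def cycle_graph_def)

lemma side_Suc_Suc [simp]: "side (Suc (Suc t)) = side t"
  by (simp add: side_def)

lemma side_subset: "side t \<subseteq> pverts G"
  using bip by (auto simp: side_def bipartition_def)

lemma sides: "side t \<union> side (Suc t) = pverts G" "side t \<inter> side (Suc t) = {}"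
  using bip by (auto simp: side_def bipartition_def)

lemma side_in_H: "u \<in> side t \<Longrightarrow> (u, s mod n) \<in> pverts H"
  using side_subset n_ge by (auto simp: pverts_H)

lemma arc_side: "(u, w) \<in> parcs G \<Longrightarrow> u \<in> side t \<Longrightarrow> w \<in> side (Suc t)"
  using bip by (auto simp: side_def bipartition_def split: if_splits)

lemma layer_subset_side: "layer S t \<subseteq> side t"
  by (auto simp: layer_def)

lemma finite_side: "finite (side t)"
  using side_subset pair_finite_verts by (rule finite_subset)

lemma finite_layer: "finite (layer S t)"
  using layer_subset_side finite_side by (rule finite_subset)

lemma layer_period: "layer S (t + 2 * n) = layer S t"
proof -
  have "(t + 2 * n) mod n = t mod n" by simp
  moreover have "side (t + 2 * n) = side t" by (simp add: side_def)
  ultimately show ?thesis unfolding layer_def by simp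
qed

section \<open>Adjacency and degrees in the product\<close>

text \<open>The centre is indexed by \<open>Suc t\<close>, so that its predecessor is
  \<open>t\<close> and no truncated subtraction occurs.\<close>

lemma cycle_neighbors: "neighborhood (cycle_graph n) (Suc t mod n) = {t mod n, Suc (Suc t) mod n}"
proof -
  have inj: "Suc t mod n = Suc j mod n \<longleftrightarrow> j = t mod n" if "j < n" for j
    using that n_ge by (auto simp: mod_Suc)
  have less: "t mod n < n" "Suc t mod n < n" "Suc (Suc t) mod n < n" using n_ge by simp_all
  have "(Suc t mod n, u) \<in> parcs (cycle_graph n) \<longleftrightarrow>
      u < n \<and> (u = Suc (Suc t mod n) mod n \<or> Suc t mod n = Suc u mod n)" for u
    using less(2) by (simp add: cycle_graph_def)
  then show ?thesis
    unfolding neighborhood_def mod_Suc_eq using inj less by blast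
qed

lemma neighborhood_H:
  "neighborhood H (u, Suc t mod n) = neighborhood G u \<times> {t mod n, Suc (Suc t) mod n}"
  using cycle_neighbors[of t] by (auto simp: neighborhood_def direct_product_def)

lemma arc_up:
  assumes "(u, w) \<in> parcs G" shows "((u, t mod n), (w, Suc t mod n)) \<in> parcs H"
proof -
  have "(u, t mod n) \<in> neighborhood H (w, Suc t mod n)"
    unfolding neighborhood_H using arc_sym[OF assms] by (simp add: neighborhood_def)
  then show ?thesis unfolding neighborhood_def by (blast intro: H.arc_sym)
qed

lemma arc_down: "(u, w) \<in> parcs G \<Longrightarrow> ((u, Suc t mod n), (w, t mod n)) \<in> parcs H"
  using arc_up arc_sym H.arc_sym by blast

lemma card_neighborhood_H:
  assumes "i < n"
  shows "card (neighborhood H (u, i)) = 2 * card (neighborhood G u)"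
proof -
  \<comment> \<open>Adding \<open>n\<close> gives \<open>i\<close> a predecessor also when
    \<open>i = 0\<close>.\<close>
  define t where "t = i + n - 1"
  have i: "i = Suc t mod n" using assms by (simp add: t_def)
  have "t mod n \<noteq> Suc (Suc t) mod n"
    using n_ge by (simp add: mod_Suc)
  then show ?thesis
    unfolding i neighborhood_H by (simp add: card_cartesian_product)
qed

text \<open>Both the residue modulo \<open>n\<close> and the parity of \<open>t\<close> are known, and \<open>n\<close> is odd.\<close>

lemma layer_index_unique:
  assumes "u \<in> side t" "u \<in> side t'" "t mod n = t' mod n" "t \<le> t'" "t' < t + 2 * n"
  shows "t = t'"
proof -
  have "even t = even t'"
    using assms(1,2) bip by (auto simp: side_def bipartition_def split: if_splits)
  then have "2 dvd t' - t" using assms(4) by (simp add: even_diff_nat)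
  moreover have "n dvd t' - t" using mod_eq_dvd_iff_nat[OF assms(4), of n] assms(3) by simp
  moreover have "coprime 2 n" using n_odd by simp
  ultimately have "2 * n dvd t' - t" by (rule divides_mult)
  then have "\<not> 0 < t' - t" using assms(5) dvd_imp_le[of "2 * n" "t' - t"] by linarith
  then show ?thesis using assms(4) by simp
qed

text \<open>Since \<open>n\<close> is odd, \<open>i\<close> and \<open>i + n\<close> have opposite
  parity, so one of them fits the side of \<open>u\<close>. If it lies below \<open>k\<close>, a
  shift by one period moves it into the window.\<close>

lemma layer_index_exists:
  assumes "(u, i) \<in> pverts H" "k \<le> 2 * n"
  obtains t where "k \<le> t" "t < k + 2 * n" "u \<in> side t" "t mod n = i"
proof -
  have u: "u \<in> pverts G" and i: "i < n" using assms by (auto simp: pverts_H)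
  define r where "r = (if u \<in> side i then i else i + n)"
  have "side (i + n) = side (Suc i)" using n_odd by (simp add: side_def)
  then have r: "r < 2 * n" "r mod n = i" "u \<in> side r"
    using i u sides(1)[of i] by (auto simp: r_def)
  show ?thesis
  proof (cases "k \<le> r")
    case True
    then show ?thesis using that[of r] r by auto
  next
    case False
    have "side (r + 2 * n) = side r" by (simp add: side_def)
    then show ?thesis using that[of "r + 2 * n"] r False assms(2) by auto
  qed
qed

section \<open>Averaging over the copies of \<open>G\<close>\<close>

text \<open>Uniqueness of the index means that a vertex of \<open>S\<close> is counted in at most
  one layer.\<close>

lemma sum_card_layers_le:
  assumes "finite S"
  shows "(\<Sum>t<2 * n. card (layer S t)) \<le> card S"
proof -
  let ?A = "SIGMA t:{..<2 * n}. layer S t"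
  have "inj_on (\<lambda>(t, u). (u, t mod n)) ?A"
  proof (rule inj_onI, clarify)
    fix t u t' u'
    assume *: "t < 2 * n" "u \<in> layer S t" "t' < 2 * n" "u \<in> layer S t'" "t mod n = t' mod n"
    show "t = t' \<and> u = u"
      using * layer_index_unique[of u t t'] layer_index_unique[of u t' t]
      by (cases "t \<le> t'") (auto simp: layer_def)
  qed
  moreover have "(\<lambda>(t, u). (u, t mod n)) ` ?A \<subseteq> S" by (auto simp: layer_def)
  ultimately have "card ?A \<le> card S" using assms by (rule card_inj_on_le)
  then show ?thesis using finite_layer by simp
qed

text \<open>Each layer belongs to two of the \<open>2 * n\<close> copies, so the losses of all
  copies add up to at most \<open>2 * card S\<close>.\<close>

lemma light_copy_exists:
  assumes "finite S" "2 * card S < 2 * n * k"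
  obtains j where "j < 2 * n" "card (layer S j) + card (layer S (Suc j)) < k"
proof -
  let ?f = "\<lambda>t. card (layer S t)"
  have shift: "(\<Sum>t<2 * n. ?f (Suc t)) = (\<Sum>t<2 * n. ?f t)"
  proof -
    have "(\<Sum>t<2 * n. ?f (Suc t)) + ?f 0 = (\<Sum>t<Suc (2 * n). ?f t)"
      by (subst sum.lessThan_Suc_shift) simp
    then show ?thesis using layer_period[of S 0] by simp
  qed
  have "\<exists>j<2 * n. ?f j + ?f (Suc j) < k"
  proof (rule ccontr)
    assume "\<not> ?thesis"
    then have "(\<Sum>t<2 * n. k) \<le> (\<Sum>t<2 * n. ?f t + ?f (Suc t))"
      by (intro sum_mono) (meson lessThan_iff not_less)
    then have "2 * n * k \<le> 2 * (\<Sum>t<2 * n. ?f t)"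
      by (simp add: sum.distrib shift)
    then show False using sum_card_layers_le[OF assms(1)] assms(2) by linarith
  qed
  then show ?thesis using that by blast
qed

section \<open>Structure of a small cut\<close>

text \<open>The two boundary layers of \<open>F\<close> already take \<open>d + d\<close> vertices
  of \<open>S\<close>, so every estimate is an equality.\<close>

lemma cut_is_neighborhood:
  assumes conn: "Digraph_Component.connected (with_proj G)"
    and deg: "\<And>u. u \<in> pverts G \<Longrightarrow> d \<le> card (neighborhood G u)"
    and large: "d < card X" "d < card Y"
    and S: "S \<subseteq> pverts H" "card S \<le> 2 * d"
    and F: "edge_closed H (pverts H - S) F" "F \<noteq> {}"
    and j: "j < 2 * n" "layer F j = {}" "layer F (Suc j) = {}"
  shows "\<exists>v\<in>pverts H. S = neighborhood H v"
proof -
  have finS: "finite S" using S(1) H.pair_finite_verts by (rule finite_subset)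
  have FH: "F \<subseteq> pverts H - S" using F(1) by (simp add: edge_closed_def)
  have up: "w \<in> layer S (Suc t) \<or> w \<in> layer F (Suc t)"
    if u: "u \<in> layer F t" and uw: "(u, w) \<in> parcs G" for u w t
  proof -
    have "u \<in> side t" "(u, t mod n) \<in> F" using u by (simp_all add: layer_def)
    then have "w \<in> side (Suc t)" "(w, Suc t mod n) \<notin> S \<Longrightarrow> (w, Suc t mod n) \<in> F"
      using arc_side[OF uw] side_in_H edge_closedD[OF F(1) _ arc_up[OF uw, of t]] by blast+
    then show ?thesis unfolding layer_def by blast
  qed
  have down: "w \<in> layer S t \<or> w \<in> layer F t"
    if u: "u \<in> layer F (Suc t)" and uw: "(u, w) \<in> parcs G" for u w t
  proof -
    have "u \<in> side (Suc t)" "(u, Suc t mod n) \<in> F" using u by (simp_all add: layer_def)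
    then have "w \<in> side t" "(w, t mod n) \<notin> S \<Longrightarrow> (w, t mod n) \<in> F"
      using arc_side[OF uw, of "Suc t"] side_in_H edge_closedD[OF F(1) _ arc_down[OF uw, of t]]
      unfolding side_Suc_Suc by blast+
    then show ?thesis unfolding layer_def by blast
  qed

  \<comment> \<open>The cyclic sequence is cut open at the copy that \<open>F\<close>
    misses.\<close>
  define I where "I = {t \<in> {j..<j + 2 * n}. layer F t \<noteq> {}}"
  have finI: "finite I" by (simp add: I_def)
  obtain u0 i0 where ui: "(u0, i0) \<in> F" using F(2) by auto
  obtain t0 where "j \<le> t0" "t0 < j + 2 * n" "u0 \<in> side t0" "t0 mod n = i0"
    using layer_index_exists[of u0 i0 j] ui FH j(1) by auto
  then have "t0 \<in> I" using ui by (auto simp: I_def layer_def)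
  then have neI: "I \<noteq> {}" by auto
  define b where "b = Max I"
  have aI: "Min I \<in> I" and bI: "b \<in> I" using finI neI by (auto simp: b_def)
  \<comment> \<open>Both layers of the copy are empty, so the layer \<open>p\<close> before the
    first one met still satisfies \<open>j < p\<close>. This keeps \<open>p\<close> and
    \<open>Suc b\<close> less than one period apart.\<close>
  have "Min I \<noteq> j" "Min I \<noteq> Suc j" "j \<le> Min I" using aI j by (auto simp: I_def)
  then obtain p where a: "Min I = Suc p" "j < p" by (cases "Min I") auto
  have pb: "p < b" using a bI finI by (metis Min_le Suc_le_eq)
  have bj: "b < j + 2 * n" using bI by (auto simp: I_def)
  have Fp: "layer F p = {}"
  proof (rule ccontr)
    assume "layer F p \<noteq> {}"
    then have "p \<in> I" using a pb bj by (auto simp: I_def)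
    then show False using Min_le[OF finI, of p] a by simp
  qed
  have Fb: "layer F (Suc b) = {}"
  proof (cases "Suc b < j + 2 * n")
    case True
    have "Suc b \<notin> I" using Max_ge[OF finI, of "Suc b"] by (auto simp: b_def)
    then show ?thesis using True bI by (auto simp: I_def)
  next
    case False
    \<comment> \<open>The window wraps around: \<open>Suc b\<close> is layer \<open>j\<close>
      again.\<close>
    then have "Suc b = j + 2 * n" using bj by simp
    then show ?thesis using layer_period j(2) by metis
  qed
  obtain u where u: "u \<in> layer F (Suc p)" using aI a by (auto simp: I_def)
  obtain u' where u': "u' \<in> layer F b" using bI by (auto simp: I_def)

  let ?A = "layer S p \<times> {p mod n}" and ?B = "layer S (Suc b) \<times> {Suc b mod n}"
  have nA: "neighborhood G u \<subseteq> layer S p"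
    using down[OF u] Fp by (auto simp: neighborhood_def)
  have nB: "neighborhood G u' \<subseteq> layer S (Suc b)"
    using up[OF u'] Fb by (auto simp: neighborhood_def)
  have dA: "d \<le> card (neighborhood G u)" and dB: "d \<le> card (neighborhood G u')"
    using deg u u' layer_subset_side side_subset by blast+
  have cA: "card (neighborhood G u) \<le> card (layer S p)"
    and cB: "card (neighborhood G u') \<le> card (layer S (Suc b))"
    using nA nB finite_layer by (auto intro: card_mono)
  have disj: "?A \<inter> ?B = {}"
    using layer_index_unique[of _ p "Suc b"] pb a bj by (auto simp: layer_def)
  have sub: "?A \<union> ?B \<subseteq> S" by (auto simp: layer_def)
  have card_AB: "card (?A \<union> ?B) = card (layer S p) + card (layer S (Suc b))"
    using disj finite_layer by (subst card_Un_disjoint) (auto simp: card_cartesian_product)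
  have "card (?A \<union> ?B) \<le> card S" using sub finS by (intro card_mono)
  then have cardA: "card (layer S p) = d" and cardB: "card (layer S (Suc b)) = d"
    using card_AB S(2) dA dB cA cB by linarith+
  have S_eq: "S = ?A \<union> ?B"
  proof -
    have "card (?A \<union> ?B) = card S"
      using card_AB cardA cardB S(2) card_mono[OF finS sub] by linarith
    then show ?thesis using card_subset_eq[OF finS sub] by blast
  qed

  show ?thesis
  proof (cases "Suc p = b")
    case True
    have eqA: "neighborhood G u = layer S p"
      using nA cA cardA dA finite_layer by (intro card_subset_eq) auto
    have "neighborhood G u \<subseteq> layer S (Suc b)"
      using up[of u b] u Fb True by (auto simp: neighborhood_def)
    then have eqB: "neighborhood G u = layer S (Suc b)"
      using cardB dA eqA cardA finite_layer by (intro card_subset_eq) auto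
    have "S = neighborhood H (u, Suc p mod n)"
      unfolding neighborhood_H using S_eq eqA eqB True by auto
    moreover have "(u, Suc p mod n) \<in> pverts H"
      using u layer_subset_side side_in_H by blast
    ultimately show ?thesis by blast
  next
    case False
    then have pb2: "Suc p < b" using pb by simp
    \<comment> \<open>All of \<open>S\<close> lies in layers \<open>p\<close> and
      \<open>Suc b\<close>; a further index strictly between them would contradict
      uniqueness.\<close>
    have S_empty: "layer S t = {}" if t: "p < t" "t \<le> b" for t
    proof (rule ccontr)
      assume "layer S t \<noteq> {}"
      then obtain w where w: "w \<in> side t" "(w, t mod n) \<in> S" by (auto simp: layer_def)
      then consider "w \<in> side p" "t mod n = p mod n"
        | "w \<in> side (Suc b)" "t mod n = Suc b mod n"
        using S_eq layer_subset_side by blast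
      then show False
        using layer_index_unique[of w p t] layer_index_unique[of w t "Suc b"] w t a bj
        by cases auto
    qed
    \<comment> \<open>These two consecutive layers form a copy of \<open>G\<close> free of
      \<open>S\<close>, so \<open>F\<close> cannot be left inside it.\<close>
    let ?C = "layer F (Suc p) \<union> layer F (Suc (Suc p))"
    have "edge_closed G (pverts G) ?C"
      unfolding edge_closed_def
    proof (intro conjI ballI impI)
      show "?C \<subseteq> pverts G" using layer_subset_side side_subset by blast
      fix x w assume "x \<in> ?C" "(x, w) \<in> parcs G"
      then show "w \<in> ?C"
        using up[of x "Suc p" w] down[of x "Suc p" w] S_empty[of "Suc p"]
          S_empty[of "Suc (Suc p)"] pb2 by auto
    qed
    then have C: "?C = pverts G" using conn u by (auto simp: connected_iff)
    \<comment> \<open>Each \<open>w\<close> here has a neighbour in layer \<open>Suc p\<close>, all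
      of which lies in \<open>F\<close>; as \<open>F\<close> misses layer \<open>p\<close>,
      \<open>w\<close> is in \<open>S\<close>. This puts more than \<open>d\<close> vertices into
      layer \<open>p\<close> of \<open>S\<close>.\<close>
    have "side p \<subseteq> layer S p"
    proof
      fix w assume w: "w \<in> side p"
      \<comment> \<open>An isolated vertex would be all of the connected graph \<open>G\<close>, yet
        \<open>u\<close> lies on the other side.\<close>
      have "\<exists>x. (w, x) \<in> parcs G"
      proof (rule ccontr)
        assume "\<not> ?thesis"
        then have "edge_closed G (pverts G) {w}"
          using w side_subset by (auto simp: edge_closed_def)
        then have "pverts G = {w}" using conn by (auto simp: connected_iff)
        moreover have "u \<in> side (Suc p)" using u layer_subset_side by blast
        ultimately show False using w sides[of p] by auto
      qed
      then obtain x where x: "(w, x) \<in> parcs G" ..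
      have "x \<in> side (Suc p)" using arc_side[OF x w] .
      moreover have "layer F (Suc (Suc p)) \<subseteq> side p"
        using layer_subset_side[of F "Suc (Suc p)"] by simp
      ultimately have "x \<in> layer F (Suc p)"
        using C sides[of p] by blast
      then show "w \<in> layer S p" using down[OF _ arc_sym[OF x]] Fp by auto
    qed
    then have "card (side p) \<le> d"
      using cardA finite_layer by (metis card_mono)
    then show ?thesis using large by (auto simp: side_def split: if_splits)
  qed
qed

text \<open>In a copy that \<open>S\<close> leaves connected, a closed set contains everything or
  nothing outside \<open>S\<close>. Hence it or its complement misses the copy and can serve as
  \<open>F\<close>.\<close>

lemma small_cut_is_neighborhood:
  assumes conn: "Digraph_Component.connected (with_proj G)"
    and deg: "\<And>u. u \<in> pverts G \<Longrightarrow> d \<le> card (neighborhood G u)"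
    and large: "d < card X" "d < card Y"
    and kappa: "2 * d < n * connectivity G"
    and S: "vertex_cut H S" "card S \<le> 2 * d"
  shows "\<exists>v\<in>pverts H. S = neighborhood H v"
proof -
  have SH: "S \<subseteq> pverts H" and SH': "pverts H - S \<noteq> {}"
    and disc: "\<not> Digraph_Component.connected (with_proj H \<restriction> (pverts H - S))"
    using S(1) by (auto simp: vertex_cut_def)
  have finS: "finite S" using SH H.pair_finite_verts by (rule finite_subset)
  have "2 * card S < 2 * n * connectivity G" using S(2) kappa by linarith
  then obtain j where j: "j < 2 * n"
    and light: "card (layer S j) + card (layer S (Suc j)) < connectivity G"
    using light_copy_exists[OF finS] by blast
  define T where "T = layer S j \<union> layer S (Suc j)"
  have cardT: "card T < connectivity G"
    using light card_Un_le[of "layer S j" "layer S (Suc j)"] by (simp add: T_def)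
  have TV: "T \<subseteq> pverts G" unfolding T_def using layer_subset_side side_subset by blast

  have connT: "Digraph_Component.connected (with_proj G \<restriction> (pverts G - T))"
    using connected_after_small_removal[OF TV cardT] .
  obtain C where C: "edge_closed H (pverts H - S) C" "C \<noteq> {}" "C \<noteq> pverts H - S"
    using disc SH' H.connected_induce_iff[OF Diff_subset] by blast
  let ?P = "\<lambda>F. layer F j = {} \<and> layer F (Suc j) = {}"
  have "?P C \<or> ?P (pverts H - S - C)"
  proof -
    let ?D = "layer C j \<union> layer C (Suc j)"
    have W: "w \<in> side t \<Longrightarrow> w \<notin> layer S t \<Longrightarrow> (w, t mod n) \<in> pverts H - S" for w t
      using side_in_H by (auto simp: layer_def)
    have "edge_closed G (pverts G - T) ?D"
      unfolding edge_closed_def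
    proof (intro conjI ballI impI)
      show "?D \<subseteq> pverts G - T"
      proof
        fix x assume "x \<in> ?D"
        moreover have "layer C t \<inter> layer S t = {}" for t
          using C(1) by (auto simp: layer_def edge_closed_def)
        ultimately show "x \<in> pverts G - T"
          using sides[of j] layer_subset_side[of C] layer_subset_side[of S]
          unfolding T_def by blast
      qed
      fix x w assume x: "x \<in> ?D" and w: "w \<in> pverts G - T" and xw: "(x, w) \<in> parcs G"
      show "w \<in> ?D"
        using x
      proof
        assume x: "x \<in> layer C j"
        then have "w \<in> side (Suc j)" using arc_side[OF xw] by (auto simp: layer_def)
        then show ?thesis
          using edge_closedD[OF C(1) _ arc_up[OF xw]] x W w by (auto simp: layer_def T_def)
      next
        assume x: "x \<in> layer C (Suc j)"
        then have "w \<in> side j" using arc_side[OF xw, of "Suc j"] by (auto simp: layer_def)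
        then show ?thesis
          using edge_closedD[OF C(1) _ arc_down[OF xw]] x W w by (auto simp: layer_def T_def)
      qed
    qed
    then consider "?D = {}" | "?D = pverts G - T"
      using connT connected_induce_iff[OF Diff_subset] by blast
    then show ?thesis
    proof cases
      \<comment> \<open>\<open>C\<close> takes all of the copy outside \<open>S\<close>, so the
        complement misses both layers.\<close>
      case 2
      have "w \<in> layer C t" if t: "t = j \<or> t = Suc j" and w: "w \<in> side t" "w \<notin> layer S t" for w t
        using 2 t w sides[of j] layer_subset_side[of C] layer_subset_side[of S]
        unfolding T_def by blast
      then show ?thesis by (fastforce simp: layer_def)
    qed simp
  qed
  then obtain F where "edge_closed H (pverts H - S) F" "F \<noteq> {}" "?P F"
    using C H.edge_closed_compl[OF C(1)] by (metis Diff_eq_empty_iff edge_closed_def subset_antisym)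
  then show ?thesis
    using cut_is_neighborhood[OF conn deg large SH S(2) _ _ j] by blast
qed

end

section \<open>From small cuts to minimum cuts\<close>

theorem theorem3p5:
  fixes G :: "'a pair_pre_digraph" and X Y :: "'a set" and n :: nat
  assumes "pair_graph G"
    and "Digraph_Component.connected (with_proj G)"
    and "bipartition G X Y"
    and "n \<ge> 3" and "odd n"
    and "card X \<ge> min_degree G + 1"
    and "card Y \<ge> min_degree G + 1"
    and "real (connectivity G) > 2 / real n * real (min_degree G)"
  shows "super_connected (direct_product G (cycle_graph n))"
  unfolding super_connected_def
proof (intro allI impI)
  interpret bipartite_times_odd_cycle G X Y n
    using assms by (intro bipartite_times_odd_cycle.intro bipartite_times_odd_cycle_axioms.intro)
  fix S assume S: "minimum_vertex_cut H S"
  have "real (2 * min_degree G) < real (n * connectivity G)"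
    using assms(4,8) by (simp add: field_simps)
  then have kappa: "2 * min_degree G < n * connectivity G"
    by (simp only: of_nat_less_iff)
  have ne: "pverts G \<noteq> {}" using assms(2) by (simp add: connected_iff)
  obtain g where g: "g \<in> pverts G" "card (neighborhood G g) = min_degree G"
    using min_degree_attained[OF ne] .
  \<comment> \<open>A vertex over \<open>g\<close> has degree twice the minimum degree of
    \<open>G\<close>. The vertex \<open>(g, 1)\<close> is a nonneighbour because \<open>G\<close>
    has no loops.\<close>
  have "connectivity H \<le> card (neighborhood H (g, 0))"
  proof (rule H.connectivity_le_card_neighborhood)
    show "(g, 0) \<in> pverts H" "(g, 1) \<in> pverts H" using g n_ge by (auto simp: pverts_H)
    show "((g, 0), (g, 1)) \<notin> parcs H"
      using no_loop by (auto simp: direct_product_def)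
  qed simp
  then have "connectivity H \<le> 2 * min_degree G"
    using card_neighborhood_H[of 0 g] g n_ge by simp
  then have card_S: "card S \<le> 2 * min_degree G" and "vertex_cut H S"
    using S by (auto simp: minimum_vertex_cut_def)
  moreover have "min_degree G < card X" "min_degree G < card Y" using assms(6,7) by simp_all
  ultimately obtain v where v: "v \<in> pverts H" "S = neighborhood H v"
    using small_cut_is_neighborhood[OF assms(2) min_degree_le _ _ kappa] by blast
  have "pverts H \<noteq> {}" using v by auto
  then obtain x where x: "x \<in> pverts H" "card (neighborhood H x) = min_degree H"
    by (rule H.min_degree_attained)
  \<comment> \<open>With \<open>card S\<close> at most \<open>2 * min_degree G\<close>, this forces
    \<open>v\<close> to have minimum degree.\<close>
  have "2 * min_degree G \<le> min_degree H"
  proof -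
    obtain u i where ui: "x = (u, i)" "u \<in> pverts G" "i < n"
      using x(1) by (cases x) (auto simp: pverts_H)
    then have "min_degree H = 2 * card (neighborhood G u)"
      using x(2) card_neighborhood_H by simp
    then show ?thesis using min_degree_le[OF ui(2)] by simp
  qed
  moreover have "card (neighborhood H v) \<le> 2 * min_degree G"
    using v card_S by simp
  ultimately have "out_degree (with_proj H) v = min_degree H"
    using H.min_degree_le[OF v(1)] by (simp add: out_degree_eq_card_neighborhood)
  then show "\<exists>v\<in>pverts H. out_degree (with_proj H) v = min_degree H \<and> S = neighborhood H v"
    using v by blast
qed

end
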